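(* For every choice of positive real parameters $\alpha,\beta,\gamma,A,B,C$, every solution $\{x_n\}_{n\ge -1}$ of the difference equation $$x_{n+1}=\frac{\alpha+\beta x_n+\gamma x_{n-1}}{Bx_n+Cx_{n-1}},\quad n=0,1,2,\dots,\qquad x_{-1},x_0\in(0,\infty),$$ converges to the (unique) positive equilibrium or to a prime period-two solution.
   Context: A solution is a sequence $\{x_n\}_{n\ge -1}$ with initial values in the indicated set satisfying the recursion. (The parameter $A$ does not occur in the equation.) An equilibrium is a number $\overline{x}$ in the domain such that the constant sequence $x_n=\overline{x}$ is a solution; the equation above has a unique positive equilibrium. A prime period-two solution is a solution $\{p_n\}_{n\ge -1}$ with $p_{n+2}=p_n$ for all $n\ge -1$ and $p_{-1}\neq p_0$. A solution $\{x_n\}$ converges to a prime period-two solution $\{p_n\}$ if $x_n-p_n\to 0$ as $n\to\infty$ (equivalently, the even- and odd-indexed subsequences of $\{x_n\}$ converge to the two distinct values of $\{p_n\}$). *)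

theory Defs imports Complex_Main begin

text \<open>
  The sequences of interest are indexed by the integers from -1 on.  They are modelled by
  functions on the naturals with the index shifted by one: the value at k stands for the
  term with index k - 1.  Thus \<open>x 0\<close> and \<open>x 1\<close> are the two initial values.
\<close>

definition is_solution ::
  "real \<Rightarrow> real \<Rightarrow> real \<Rightarrow> real \<Rightarrow> real \<Rightarrow> (nat \<Rightarrow> real) \<Rightarrow> bool" where
  "is_solution \<alpha> \<beta> \<gamma> B C x \<longleftrightarrow>
     x 0 \<in> {0<..} \<and> x 1 \<in> {0<..} \<and>
     (\<forall>n. x (n + 2) = (\<alpha> + \<beta> * x (n + 1) + \<gamma> * x n) / (B * x (n + 1) + C * x n))"

text \<open>Positivity of an equilibrium is part of being a solution.\<close>

definition is_equilibrium ::
  "real \<Rightarrow> real \<Rightarrow> real \<Rightarrow> real \<Rightarrow> real \<Rightarrow> real \<Rightarrow> bool" where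
  "is_equilibrium \<alpha> \<beta> \<gamma> B C e \<longleftrightarrow> is_solution \<alpha> \<beta> \<gamma> B C (\<lambda>_. e)"

definition is_prime_period_two ::
  "real \<Rightarrow> real \<Rightarrow> real \<Rightarrow> real \<Rightarrow> real \<Rightarrow> (nat \<Rightarrow> real) \<Rightarrow> bool" where
  "is_prime_period_two \<alpha> \<beta> \<gamma> B C p \<longleftrightarrow>
     is_solution \<alpha> \<beta> \<gamma> B C p \<and> (\<forall>n. p (n + 2) = p n) \<and> p 0 \<noteq> p 1"

end

theory Submission imports Defs "HOL-Analysis.Analysis" begin

text \<open>
  Dividing a solution by the equilibrium turns the equation into
  \<open>w = (R + P u + G v) / (q u + v)\<close> with \<open>R + P + G = q + 1\<close>, where \<open>v\<close>, \<open>u\<close>, \<open>w\<close> are three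
  consecutive terms and the equilibrium is 1.  Subtracting the equation of the equilibrium gives
  \<open>(q u + v) (w - 1) = (P - q) (u - 1) + (G - 1) (v - 1)\<close>, and the signs of \<open>P - q\<close> and \<open>G - 1\<close>
  (which cannot both be nonnegative, as their sum is \<open>- R\<close>) decide the behaviour.

  If \<open>P \<le> q\<close> and \<open>G \<le> 1\<close>, then \<open>w\<close> is a weighted mean of 1 and the reciprocal of a weighted mean
  of \<open>u\<close> and \<open>v\<close>.  So the smallest interval \<open>[1/m, m]\<close> that contains two consecutive terms shrinks
  every two steps, and the solution tends to 1 (\<open>settles_if_P_le_q_G_le_1\<close>).

  If \<open>P \<le> q\<close> and \<open>G \<ge> 1\<close>, period two is possible.  A solution that stays on one side of 1
  is monotone; any other solution eventually alternates around 1.  The right-hand side decreases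
  in \<open>u\<close>, and it increases in \<open>v\<close> as long as \<open>u\<close> is at least \<open>R / (G q - P)\<close>.  Once an
  upper term of an alternating solution is at most \<open>G\<close>, all later terms satisfy this bound, and a
  mixed monotone recursion has eventually monotone even and odd parts.  Otherwise the lower terms
  increase, and the gap between lower and upper terms is controlled by that increase, so that the
  solution tends to 1 (\<open>settles_if_P_le_q_G_ge_1\<close>).

  If \<open>P > q\<close>, put \<open>l = (P - q) / (1 - G)\<close>, which lies in \<open>(0, 1)\<close>.  Then \<open>w\<close> is a weighted mean
  of 1 and \<open>((1 - l) + l u) / v\<close>, the next term of the Lyness equation.  As the weight of 1 tends
  to 0 the map tends to the Lyness map, all of whose orbits lie on level curves
  of an invariant \<open>lyness l\<close>; this suggests looking for a perturbation of the invariant.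
  The invariant alone is not monotone along solutions, but its change splits into a part with the
  factor \<open>G\<close> and one with the factor \<open>q\<close>, and each is compensated by the increment of a function of
  the newest term only.  The two resulting inequalities in \<open>u\<close> and \<open>w\<close> are sums of squares
  (\<open>reciprocal_change_less\<close>, \<open>quadratic_change_le\<close>), so the sum of the three functions decreases
  strictly away from the equilibrium (\<open>settles_if_q_less_P\<close>).
\<close>

section \<open>Two convergence principles\<close>

text \<open>
  Along a subsequence that stays away from \<open>e\<close> and converges to some \<open>a\<close>, the values of \<open>V\<close> tend to
  the limit of the decreasing sequence \<open>V (z n)\<close>; so do those of the iterates, which contradicts a
  strict decrease from \<open>a\<close>.  Asking for strictness only after two steps admits functions such as
  the maximum over the last two terms, which may stay constant for one step.
\<close>
lemma strict_Lyapunov_function_attracts: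
  fixes z :: "nat \<Rightarrow> 'a::metric_space" and V :: "'a \<Rightarrow> real"
  assumes K: "compact K" "\<And>n. z n \<in> K"
    and T: "\<And>n. z (Suc n) = T (z n)" "continuous_on K T"
    and V: "continuous_on K V" "\<And>n. V (z (Suc n)) \<le> V (z n)"
    and strict: "\<And>a. a \<in> K \<Longrightarrow> a \<noteq> e \<Longrightarrow> V (T (T a)) < V a"
  shows "z \<longlonglongrightarrow> e"
proof (rule ccontr)
  assume "\<not> z \<longlonglongrightarrow> e"
  then obtain \<epsilon> where \<epsilon>: "\<epsilon> > 0" and far: "\<And>N. \<exists>n\<ge>N. \<epsilon> \<le> dist (z n) e"
    unfolding lim_sequentially by (meson not_less)
  have inf: "infinite {n. \<epsilon> \<le> dist (z n) e}"
    unfolding infinite_nat_iff_unbounded_le using far by auto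
  define g where "g = enumerate {n. \<epsilon> \<le> dist (z n) e}"
  have g: "strict_mono g" "\<And>n. \<epsilon> \<le> dist (z (g n)) e"
    using strict_mono_enumerate[OF inf] enumerate_in_set[OF inf] by (auto simp: g_def)
  have "seq_compact K"
    using K(1) compact_eq_seq_compact_metric by blast
  then obtain a r where a: "a \<in> K" and r: "strict_mono r"
    and lim: "(\<lambda>n. z (g (r n))) \<longlonglongrightarrow> a"
    using K(2) by (elim seq_compactE[where f = "\<lambda>n. z (g n)"]) (auto simp: o_def)
  have "(\<lambda>n. dist (z (g (r n))) e) \<longlonglongrightarrow> dist a e"
    by (intro tendsto_intros lim)
  then have "\<epsilon> \<le> dist a e"
    by (rule LIMSEQ_le_const) (use g(2) in auto)
  then have ne: "a \<noteq> e"
    using \<epsilon> by auto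
  have step: "(\<lambda>n. z (Suc (h n))) \<longlonglongrightarrow> T b \<and> T b \<in> K"
    if "b \<in> K" "(\<lambda>n. z (h n)) \<longlonglongrightarrow> b" for b and h :: "nat \<Rightarrow> nat"
  proof -
    have "(\<lambda>n. T (z (h n))) \<longlonglongrightarrow> T b"
      by (rule continuous_on_tendsto_compose[OF T(2) that(2,1)]) (use K in auto)
    then have "(\<lambda>n. z (Suc (h n))) \<longlonglongrightarrow> T b"
      by (simp add: T)
    moreover from this have "T b \<in> K"
      using closed_sequentially[OF compact_imp_closed[OF K(1)], of "\<lambda>n. z (Suc (h n))"] K(2) by auto
    ultimately show ?thesis
      by auto
  qed
  have val: "(\<lambda>n. V (z (h n))) \<longlonglongrightarrow> V b"
    if "b \<in> K" "(\<lambda>n. z (h n)) \<longlonglongrightarrow> b" for b and h :: "nat \<Rightarrow> nat"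
    by (rule continuous_on_tendsto_compose[OF V(1) that(2,1)]) (use K in auto)
  have lim1: "(\<lambda>n. z (Suc (g (r n)))) \<longlonglongrightarrow> T a" "T a \<in> K"
    using step[OF a lim] by auto
  have lim2: "(\<lambda>n. z (Suc (Suc (g (r n))))) \<longlonglongrightarrow> T (T a)" "T (T a) \<in> K"
    using step[OF lim1(2,1)] by auto
  have "bounded (V ` K)"
    by (intro compact_imp_bounded compact_continuous_image V K)
  then obtain M where M: "\<And>x. x \<in> K \<Longrightarrow> \<bar>V x\<bar> \<le> M"
    unfolding bounded_real by auto
  have "decseq (\<lambda>n. V (z n))"
    using V(2) by (simp add: decseq_Suc_iff)
  moreover have "\<And>n. - M \<le> V (z n)"
    using M K(2) by (metis abs_le_D2 minus_le_iff)
  ultimately obtain L where L: "(\<lambda>n. V (z n)) \<longlonglongrightarrow> L"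
    using decseq_convergent by metis
  have gr: "filterlim (\<lambda>n. g (r n)) sequentially sequentially"
    using filterlim_subseq[OF strict_mono_o[OF g(1) r]] by (simp add: o_def)
  have "V a = L"
    by (rule LIMSEQ_unique[OF val[OF a lim] filterlim_compose[OF L gr]])
  moreover have "V (T (T a)) = L"
    by (rule LIMSEQ_unique[OF val[OF lim2(2,1)]])
      (intro filterlim_compose[OF L] filterlim_compose[OF filterlim_Suc] gr)
  ultimately show False
    using strict[OF a ne] by simp
qed

text \<open>
  Once the terms of one parity move weakly upwards and those of the other weakly downwards,
  monotonicity propagates this pattern forever.  If this never happens, both parities always move
  strictly in one common direction.  Hence both are eventually monotone.
\<close>
lemma even_odd_convergent_if_mixed_monotone:
  fixes y :: "nat \<Rightarrow> real"
  assumes rec: "\<And>n. y (n + 2) = f (y (n + 1)) (y n)"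
    and mixed: "\<And>i j k m. y i \<le> y j \<Longrightarrow> y k \<le> y m \<Longrightarrow> f (y j) (y k) \<le> f (y i) (y m)"
    and bounded: "\<And>n. l \<le> y n" "\<And>n. y n \<le> h"
  shows "convergent (\<lambda>n. y (2 * n)) \<and> convergent (\<lambda>n. y (2 * n + 1))"
proof -
  have fall: "y (n + 1) \<le> y (n + 3) \<Longrightarrow> y (n + 2) \<le> y n \<Longrightarrow> y (n + 4) \<le> y (n + 2)"
    and rise: "y (n + 3) \<le> y (n + 1) \<Longrightarrow> y n \<le> y (n + 2) \<Longrightarrow> y (n + 2) \<le> y (n + 4)" for n
    using mixed[of "n + 1" "n + 3" "n + 2" n] mixed[of "n + 3" "n + 1" n "n + 2"]
      rec[of n] rec[of "n + 2"] by (simp_all add: numeral_eq_Suc)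
  have conv: "convergent (\<lambda>n. y (2 * n + b))"
    if "(\<forall>k. y (N + 2 * k) \<le> y (N + 2 * k + 2)) \<or> (\<forall>k. y (N + 2 * k + 2) \<le> y (N + 2 * k))"
      and "N = 2 * M + b" for N M b
  proof -
    have "monoseq (\<lambda>k. y (N + 2 * k))"
      unfolding monoseq_Suc using that(1) by (simp add: algebra_simps)
    moreover have "Bseq (\<lambda>k. y (N + 2 * k))"
    proof (rule BseqI')
      show "norm (y (N + 2 * k)) \<le> max \<bar>l\<bar> \<bar>h\<bar>" for k
        using bounded[of "N + 2 * k"] by auto
    qed
    ultimately have "convergent (\<lambda>k. y (N + 2 * k))"
      by (rule Bseq_monoseq_convergent[rotated])
    then have "convergent (\<lambda>k. y (2 * (k + M) + b))"
      by (simp add: that(2) algebra_simps)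
    then show ?thesis
      using convergent_ignore_initial_segment[of "\<lambda>n. y (2 * n + b)" M] by simp
  qed
  have all: ?thesis
    if "\<And>p. p \<in> {N, Suc N} \<Longrightarrow>
      (\<forall>k. y (p + 2 * k) \<le> y (p + 2 * k + 2)) \<or> (\<forall>k. y (p + 2 * k + 2) \<le> y (p + 2 * k))" for N
  proof (cases "even N")
    case True
    then obtain M where "N = 2 * M" by (elim evenE)
    then show ?thesis
      using conv[OF that[of N], of M 0] conv[OF that[of "Suc N"], of M 1] by simp
  next
    case False
    then obtain M where "N = 2 * M + 1" by (elim oddE)
    then show ?thesis
      using conv[OF that[of N], of M 1] conv[OF that[of "Suc N"], of "M + 1" 0] by simp
  qed
  \<comment> \<open>Without a pair of opposite moves, all increments have the strict sign of the first one.\<close>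
  consider (down) N where "y N \<le> y (N + 2)" "y (N + 3) \<le> y (N + 1)"
    | (up) N where "y (N + 2) \<le> y N" "y (N + 1) \<le> y (N + 3)"
    | (inc) "\<forall>n. y n \<le> y (n + 2)" | (dec) "\<forall>n. y (n + 2) \<le> y n"
  proof -
    {
      assume no: "\<not> (\<exists>N. y N \<le> y (N + 2) \<and> y (N + 3) \<le> y (N + 1))"
        "\<not> (\<exists>N. y (N + 2) \<le> y N \<and> y (N + 1) \<le> y (N + 3))"
      have "y n < y (n + 2) \<longleftrightarrow> y 0 < y 2" "y (n + 2) < y n \<longleftrightarrow> y 2 < y 0" for n
      proof (induction n)
        case (Suc n)
        have "y (Suc n) < y (Suc n + 2) \<longleftrightarrow> y n < y (n + 2)"
          "y (Suc n + 2) < y (Suc n) \<longleftrightarrow> y (n + 2) < y n"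
          using no[unfolded not_ex, rule_format, of n]
          by (auto simp: numeral_eq_Suc not_le)
        then show "y (Suc n) < y (Suc n + 2) \<longleftrightarrow> y 0 < y 2"
          "y (Suc n + 2) < y (Suc n) \<longleftrightarrow> y 2 < y 0"
          using Suc by auto
      qed (auto simp: numeral_2_eq_2)
      then have "(\<forall>n. y n \<le> y (n + 2)) \<or> (\<forall>n. y (n + 2) \<le> y n)"
        by (meson not_less linear)
    }
    then show thesis
      using that by blast
  qed
  then show ?thesis
  proof cases
    case down
    have "y (N + 2 * k) \<le> y (N + 2 * k + 2) \<and> y (N + 2 * k + 3) \<le> y (N + 2 * k + 1)" for k
    proof (induction k)
      case (Suc k)
      show ?case
        using rise[of "N + 2 * k"] fall[of "N + 2 * k + 1"] Suc by (simp add: numeral_eq_Suc)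
    qed (use \<open>y N \<le> y (N + 2)\<close> \<open>y (N + 3) \<le> y (N + 1)\<close> in auto)
    then show ?thesis
      by (intro all[of N]) (auto simp: numeral_eq_Suc)
  next
    case up
    have "y (N + 2 * k + 2) \<le> y (N + 2 * k) \<and> y (N + 2 * k + 1) \<le> y (N + 2 * k + 3)" for k
    proof (induction k)
      case (Suc k)
      show ?case
        using fall[of "N + 2 * k"] rise[of "N + 2 * k + 1"] Suc by (simp add: numeral_eq_Suc)
    qed (use \<open>y (N + 2) \<le> y N\<close> \<open>y (N + 1) \<le> y (N + 3)\<close> in auto)
    then show ?thesis
      by (intro all[of N]) (auto simp: numeral_eq_Suc)
  next
    case inc
    show ?thesis
      by (rule all[of 0]) (use inc in auto)
  next
    case dec
    show ?thesis
      by (rule all[of 0]) (use dec in auto)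
  qed
qed

section \<open>Perturbing the invariant of the Lyness equation\<close>

text \<open>
  The invariant of \<open>w = ((1 - l) + l u) / v\<close>, whose positive equilibrium is 1.
\<close>
definition lyness :: "real \<Rightarrow> real \<Rightarrow> real \<Rightarrow> real" where
  "lyness l v u = (l + u) * (l + v) * ((1 - l) + l * u + l * v) / (u * v)"

text \<open>
  The last factor vanishes when \<open>w\<close> is the next Lyness term, which is the invariance.  For fixed \<open>u\<close>
  the invariant takes the same value at the previous and the next Lyness term, whence the
  factor \<open>w - v\<close>.
\<close>
lemma lyness_diff:
  assumes "u > 0" "v > 0" "w > 0"
  shows "lyness l u w - lyness l v u
    = l * (l + u) / (u * w * v) * ((w - v) * (w * v - ((1 - l) + l * u)))"
  using assms unfolding lyness_def by (simp add: divide_simps) algebra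

text \<open>
  The right-hand side is a lower bound for the decrease of the invariant that comes with the
  factor \<open>G\<close>.  The function \<open>u + 1 / u\<close> is, up to an additive and a multiplicative constant, the
  invariant at \<open>(1, u)\<close>.  With the factor \<open>(1 + l) / 2\<close> the difference of the two sides is, to second
  order at \<open>u = w = 1\<close>, the multiple \<open>(1 + l) / 2\<close> of
  \<open>3 (w - 1)\<^sup>2 - 2 l (u - 1) (w - 1) + (u - 1)\<^sup>2\<close>, which is positive definite.
\<close>
lemma reciprocal_change_less:
  fixes l u w :: real
  assumes l: "0 < l" "l < 1" and pos: "u > 0" "w > 0" and ne: "u \<noteq> 1 \<or> w \<noteq> 1"
  shows "(1 + l) / 2 * (w + 1 / w) - (1 + l) / 2 * (u + 1 / u)
      < (l + u) * (w - 1) * (w - ((1 - l) + l * u) / w) / (u * w)" (is "?a < ?b")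
proof -
  define k where "k = 1 - l"
  \<comment> \<open>The difference of both sides as a combination of \<open>(w - 1)\<^sup>2\<close>, \<open>(u - 1)\<^sup>2\<close> and \<open>(u - w)\<^sup>2\<close>
    with coefficients that are polynomials in \<open>u\<close>, \<open>w\<close>, \<open>l\<close>, \<open>1 - l\<close> without negative terms.\<close>
  define S1 where "S1 = (w - 1)\<^sup>2 * (k * u * w + 2 * (l\<^sup>2 + l * k + k\<^sup>2) * u + l * (1 + l) * u\<^sup>2 + 2 * l * k * (1 + w))"
  define S2 where "S2 = k * (1 + l) * w\<^sup>2 * (u - 1)\<^sup>2"
  define S3 where "S3 = (l * k + 2 * l\<^sup>2 * w) * (u - w)\<^sup>2"
  have k: "k > 0" using l by (simp add: k_def)
  have *: "?b - ?a = (S1 + S2 + S3) / (2 * u * w\<^sup>2)"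
    unfolding S1_def S2_def S3_def k_def using pos by (simp add: divide_simps) algebra
  have coeff: "k * u * w + 2 * (l\<^sup>2 + l * k + k\<^sup>2) * u + l * (1 + l) * u\<^sup>2 + 2 * l * k * (1 + w) > 0"
    using l k pos by (intro add_pos_pos mult_pos_pos) auto
  have "S1 \<ge> 0" "S2 \<ge> 0" "S3 \<ge> 0"
    unfolding S1_def S2_def S3_def using l k pos coeff by auto
  moreover have "S1 > 0 \<or> S2 > 0"
    unfolding S1_def S2_def using ne l k pos coeff by auto
  ultimately have "S1 + S2 + S3 > 0"
    by linarith
  then have "(S1 + S2 + S3) / (2 * u * w\<^sup>2) > 0"
    using pos by simp
  then show ?thesis
    using * by linarith
qed

text \<open>
  The counterpart for the factor \<open>q\<close>.  Here the compensating function has to grow at least like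
  \<open>u\<close> at infinity (let \<open>u\<close> tend to infinity and then \<open>w\<close>), but near 0 not faster than \<open>l / u\<close> (let
  \<open>w\<close> tend to 0 and then \<open>u\<close>).  No multiple of \<open>u + 1 / u\<close> does both when \<open>l < 1\<close>, but
  \<open>l (u - 1)\<^sup>2 / ((1 - l) + l u)\<close> does; its denominator is the numerator of the Lyness equation.
\<close>
lemma quadratic_change_le:
  fixes l u w :: real
  assumes l: "0 < l" "l < 1" and pos: "u > 0" "w > 0"
  defines "m \<equiv> (1 - l) + l * u"
  shows "l * (w - 1)\<^sup>2 / ((1 - l) + l * w) - l * (u - 1)\<^sup>2 / m
      \<le> (l + u) * (w - 1) * (w\<^sup>2 / m - 1) / w" (is "?a \<le> ?b")
proof -
  define k where "k = 1 - l"
  define n where "n = (1 - l) + l * w"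
  define S where "S = (w - 1)\<^sup>2 * (k * u + k * (1 + l) * u * w + l * u * w\<^sup>2 + l\<^sup>2 * w\<^sup>2)
     + l / 2 * n * (k * (w - 1)\<^sup>2 + k * (u - 1)\<^sup>2 + (1 + l) * (u - w)\<^sup>2)"
  have k: "k > 0" using l by (simp add: k_def)
  have mn: "m > 0" "n > 0" unfolding m_def n_def using l pos by (auto intro!: add_pos_pos)
  have "?b - ?a = ((l + u) * (w - 1) * (w\<^sup>2 - m) * n + l * w * ((u - 1)\<^sup>2 * n - (w - 1)\<^sup>2 * m)) / (w * m * n)"
    unfolding n_def[symmetric] using pos mn by (simp add: divide_simps) algebra
  also have "(l + u) * (w - 1) * (w\<^sup>2 - m) * n + l * w * ((u - 1)\<^sup>2 * n - (w - 1)\<^sup>2 * m) = S"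
    unfolding S_def k_def m_def n_def by algebra
  finally have *: "?b - ?a = S / (w * m * n)" .
  have "S \<ge> 0"
    unfolding S_def using l k pos mn by (intro add_nonneg_nonneg mult_nonneg_nonneg) auto
  then have "S / (w * m * n) \<ge> 0" using pos mn by simp
  then show "?a \<le> ?b" using * by linarith
qed


section \<open>The equation with equilibrium 1\<close>

locale normalised_recursion =
  fixes R P G q :: real
  assumes pos: "R > 0" "P > 0" "G > 0" "q > 0"
    and normal: "R + P + G = q + 1"
begin

text \<open>The first argument is the newer term.\<close>
definition step :: "real \<Rightarrow> real \<Rightarrow> real" where
  "step u v = (R + P * u + G * v) / (q * u + v)"

definition orbit :: "(nat \<Rightarrow> real) \<Rightarrow> bool" where
  "orbit y \<longleftrightarrow> (\<forall>n. y n > 0) \<and> (\<forall>n. y (n + 2) = step (y (n + 1)) (y n))"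

text \<open>
  Convergence to the equilibrium is the case \<open>s = t\<close>; otherwise \<open>s\<close> and \<open>t\<close> form a prime
  period-two solution.
\<close>
definition settles :: "(nat \<Rightarrow> real) \<Rightarrow> bool" where
  "settles y \<longleftrightarrow> (\<exists>s t. s > 0 \<and> t > 0 \<and> step t s = s \<and> step s t = t \<and>
     (\<lambda>n. y (2 * n)) \<longlonglongrightarrow> s \<and> (\<lambda>n. y (2 * n + 1)) \<longlonglongrightarrow> t)"

lemma orbitD:
  assumes "orbit y"
  shows "y n > 0" "y (n + 2) = step (y (n + 1)) (y n)"
  using assms by (auto simp: orbit_def)

lemma orbit_shift: "orbit y \<Longrightarrow> orbit (\<lambda>n. y (n + N))"
  unfolding orbit_def by (metis add.assoc add.commute)

lemma settles_if_settles_shift: "settles (\<lambda>n. y (n + N)) \<Longrightarrow> settles y"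
proof (induction N)
  case (Suc N)
  define x where "x = (\<lambda>n. y (n + N))"
  have "settles (\<lambda>n. x (n + 1))"
    using Suc.prems by (simp add: x_def)
  then obtain s t where *: "s > 0" "t > 0" "step t s = s" "step s t = t"
    and lim: "(\<lambda>n. x (2 * n + 1)) \<longlonglongrightarrow> s" "(\<lambda>n. x (2 * n + 2)) \<longlonglongrightarrow> t"
    by (auto simp: settles_def)
  have "(\<lambda>n. x (2 * n)) \<longlonglongrightarrow> t"
    by (rule LIMSEQ_imp_Suc) (use lim(2) in simp)
  then have "settles x"
    unfolding settles_def using * lim(1) by blast
  then show ?case
    using Suc.IH by (simp add: x_def)
qed simp

lemma step_pos: "u > 0 \<Longrightarrow> v > 0 \<Longrightarrow> step u v > 0"
  using pos by (simp add: step_def add_pos_pos)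

lemma denominator_pos: "u > 0 \<Longrightarrow> v > 0 \<Longrightarrow> q * u + v > 0"
  using pos by (simp add: add_pos_pos)

lemma step_eq_iff:
  "u > 0 \<Longrightarrow> v > 0 \<Longrightarrow> step u v = w \<longleftrightarrow> R + P * u + G * v = w * (q * u + v)"
  unfolding step_def using denominator_pos[of u v] by (auto simp: field_simps)

lemma step_le_iff:
  "u > 0 \<Longrightarrow> v > 0 \<Longrightarrow> step u v \<le> w \<longleftrightarrow> R + P * u + G * v \<le> w * (q * u + v)"
  unfolding step_def using denominator_pos[of u v] by (simp add: pos_divide_le_eq)

lemma step_less_iff:
  "u > 0 \<Longrightarrow> v > 0 \<Longrightarrow> step u v < w \<longleftrightarrow> R + P * u + G * v < w * (q * u + v)"
  unfolding step_def using denominator_pos[of u v] by (simp add: pos_divide_less_eq)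

lemma le_step_iff:
  "u > 0 \<Longrightarrow> v > 0 \<Longrightarrow> w \<le> step u v \<longleftrightarrow> w * (q * u + v) \<le> R + P * u + G * v"
  unfolding step_def using denominator_pos[of u v] by (simp add: pos_le_divide_eq)

lemma less_step_iff:
  "u > 0 \<Longrightarrow> v > 0 \<Longrightarrow> w < step u v \<longleftrightarrow> w * (q * u + v) < R + P * u + G * v"
  unfolding step_def using denominator_pos[of u v] by (simp add: pos_less_divide_eq)

lemma step_1_1: "step 1 1 = 1"
  using normal pos by (subst step_eq_iff) auto

lemma fixed_point_unique:
  assumes "s > 0" "step s s = s"
  shows "s = 1"
proof -
  have "(s - 1) * ((q + 1) * s + R) = 0"
    using assms normal by (simp add: step_eq_iff) algebra
  moreover have "(q + 1) * s + R > 0"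
    using pos assms by (simp add: add_pos_pos)
  ultimately show ?thesis
    by auto
qed

lemma settles_if_converges:
  assumes "y \<longlonglongrightarrow> 1"
  shows "settles y"
proof -
  have "(\<lambda>n. y (2 * n)) \<longlonglongrightarrow> 1" "(\<lambda>n. y (2 * n + 1)) \<longlonglongrightarrow> 1"
    using LIMSEQ_subseq_LIMSEQ[OF assms, of "\<lambda>n. 2 * n"]
      LIMSEQ_subseq_LIMSEQ[OF assms, of "\<lambda>n. 2 * n + 1"]
    by (simp_all add: strict_mono_def o_def)
  then show ?thesis
    unfolding settles_def using step_1_1 by (intro exI[of _ 1]) auto
qed

text \<open>
  The quotient of the homogeneous parts \<open>P u + G v\<close> and \<open>q u + v\<close> lies between
  \<open>min (P / q) G\<close> and \<open>P / q + G\<close>.  The lower bound keeps the denominator away from 0, which bounds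
  the contribution of \<open>R\<close>.
\<close>
lemma orbit_bounded:
  assumes "orbit y"
  obtains l h where "0 < l" "\<And>n. l \<le> y n" "\<And>n. y n \<le> h"
proof -
  define l where "l = min (min (y 0) (y 1)) (min (P / q) G)"
  have l: "l > 0" "l \<le> P / q" "l \<le> G"
    using pos orbitD[OF assms] by (auto simp: l_def)
  have lower: "l \<le> y n \<and> l \<le> y (Suc n)" for n
  proof (induction n)
    case (Suc n)
    have "l * q \<le> P"
      using l pos by (simp add: field_simps)
    then have "l * q * y (n + 1) \<le> P * y (n + 1)" "l * y n \<le> G * y n"
      using orbitD(1)[OF assms] l by (auto intro!: mult_right_mono less_imp_le)
    then have "l * (q * y (n + 1) + y n) \<le> R + P * y (n + 1) + G * y n"
      using pos by (simp add: algebra_simps)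
    then have "l \<le> y (n + 2)"
      using orbitD[OF assms] by (simp add: le_step_iff)
    then show ?case
      using Suc by simp
  qed (auto simp: l_def)
  define h where "h = max (max (y 0) (y 1)) (R / ((q + 1) * l) + (P / q + G))"
  have upper: "y n \<le> h \<and> y (Suc n) \<le> h" for n
  proof (induction n)
    case (Suc n)
    define u v where "u = y (n + 1)" and "v = y n"
    have uv: "l \<le> u" "l \<le> v" "u > 0" "v > 0"
      using lower[of n] orbitD(1)[OF assms] by (auto simp: u_def v_def)
    have "(q + 1) * l \<le> q * u + v"
      using uv pos by (simp add: algebra_simps add_mono)
    then have "R / ((q + 1) * l) * ((q + 1) * l) \<le> R / ((q + 1) * l) * (q * u + v)"
      using pos l by (intro mult_left_mono) auto
    then have "R \<le> R / ((q + 1) * l) * (q * u + v)"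
      using pos l by simp
    moreover have "P * u + G * v \<le> (P / q + G) * (q * u + v)"
      using pos uv by (simp add: field_simps)
    ultimately have "step u v \<le> R / ((q + 1) * l) + (P / q + G)"
      using uv by (simp add: step_le_iff distrib_right)
    then have "y (n + 2) \<le> h"
      using orbitD(2)[OF assms, of n] by (simp add: u_def v_def h_def)
    then show ?case
      using Suc by simp
  qed (auto simp: h_def)
  show thesis
    using that[of l h] l(1) lower upper by blast
qed

text \<open>
  The first argument of \<open>V\<close> is the older term, so that \<open>V\<close> reads consecutive terms in their
  order along the orbit.
\<close>
lemma converges_if_Lyapunov:
  fixes V :: "real \<Rightarrow> real \<Rightarrow> real"
  assumes y: "orbit y"
    and cont: "continuous_on ({0<..} \<times> {0<..}) (\<lambda>z. V (fst z) (snd z))"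
    and mono: "\<And>u v. u > 0 \<Longrightarrow> v > 0 \<Longrightarrow> V u (step u v) \<le> V v u"
    and strict: "\<And>u v. u > 0 \<Longrightarrow> v > 0 \<Longrightarrow> u \<noteq> 1 \<or> v \<noteq> 1 \<Longrightarrow>
      V (step u v) (step (step u v) u) < V v u"
  shows "y \<longlonglongrightarrow> 1"
proof -
  obtain l h where lh: "0 < l" "\<And>n. l \<le> y n" "\<And>n. y n \<le> h"
    using orbit_bounded[OF y] by blast
  define K where "K = {l..h} \<times> {l..h}"
  define z where "z = (\<lambda>n. (y n, y (Suc n)))"
  define T where "T = (\<lambda>z. (snd z, step (snd z) (fst z)))"
  have K: "K \<subseteq> {0<..} \<times> {0<..}"
    using lh(1) by (auto simp: K_def)
  have "z \<longlonglongrightarrow> (1, 1)"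
  proof (rule strict_Lyapunov_function_attracts[where V = "\<lambda>z. V (fst z) (snd z)"])
    show "compact K"
      unfolding K_def by (intro compact_Times compact_Icc)
    show "z n \<in> K" for n
      using lh by (auto simp: K_def z_def)
    show "z (Suc n) = T (z n)" for n
      using orbitD(2)[OF y, of n] by (simp add: z_def T_def)
    have "q * snd z + fst z \<noteq> 0" if "z \<in> K" for z
      using that K denominator_pos[of "snd z" "fst z"] by (auto simp: mem_Times_iff)
    then show "continuous_on K T"
      unfolding T_def step_def by (intro continuous_intros) auto
    show "continuous_on K (\<lambda>z. V (fst z) (snd z))"
      using continuous_on_subset[OF cont K] .
    show "V (fst (z (Suc n))) (snd (z (Suc n))) \<le> V (fst (z n)) (snd (z n))" for n
      using mono[of "y (n + 1)" "y n"] orbitD[OF y] by (simp add: z_def)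
    show "V (fst (T (T a))) (snd (T (T a))) < V (fst a) (snd a)" if "a \<in> K" "a \<noteq> (1, 1)" for a
      using strict[of "snd a" "fst a"] that K by (cases a) (auto simp: T_def)
  qed
  then show ?thesis
    using tendsto_fst by (fastforce simp: z_def)
qed

section \<open>Both coefficients nonpositive: a shrinking interval\<close>

text \<open>
  With \<open>X = P u + G v\<close> and \<open>Y = (q - P) u + (1 - G) v\<close> the next term is \<open>(X + R) / (X + Y)\<close>, the mean
  of 1 and \<open>R / Y\<close> with weights \<open>X\<close> and \<open>Y\<close>.  The coefficients of \<open>Y\<close> add up to \<open>R\<close>, so \<open>R / Y\<close> is the
  reciprocal of a mean of \<open>u\<close> and \<open>v\<close>; it stays in \<open>[1/m, m]\<close> if they do, and \<open>X > 0\<close> makes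
  the inclusion strict.
\<close>
lemma settles_if_P_le_q_G_le_1:
  assumes y: "orbit y" and "P \<le> q" "G \<le> 1"
  shows "settles y"
proof -
  define M where "M = (\<lambda>v u::real. max (max u (1 / u)) (max v (1 / v)))"
  have M_less_iff: "M v u < m \<longleftrightarrow> 1 / m < u \<and> u < m \<and> 1 / m < v \<and> v < m"
    and M_le_iff: "M v u \<le> m \<longleftrightarrow> 1 / m \<le> u \<and> u \<le> m \<and> 1 / m \<le> v \<and> v \<le> m"
    if "u > 0" "v > 0" "m > 0" for u v m
    using that by (auto simp: M_def field_simps)
  have key: "1 / m < step u v" "step u v < m"
    if "m > 1" "u > 0" "v > 0" "M v u \<le> m" for u v m
  proof -
    define Y where "Y = (q - P) * u + (1 - G) * v"
    have uv: "1 / m \<le> u" "u \<le> m" "1 / m \<le> v" "v \<le> m"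
      using that by (auto simp: M_le_iff)
    have R: "R = (q - P) + (1 - G)"
      using normal by simp
    have "Y \<le> (q - P) * m + (1 - G) * m"
      unfolding Y_def using uv assms by (intro add_mono mult_left_mono) auto
    then have Y1: "Y \<le> R * m"
      by (simp add: R algebra_simps)
    have "(q - P) * (1 / m) + (1 - G) * (1 / m) \<le> Y"
      unfolding Y_def using uv assms by (intro add_mono mult_left_mono) auto
    then have "R * (1 / m) \<le> Y"
      by (simp only: R distrib_right)
    then have Y2: "R \<le> m * Y"
      using that(1) by (simp add: field_simps)
    define X where "X = P * u + G * v"
    have "X > 0"
      unfolding X_def using pos that by (simp add: add_pos_pos)
    then have X: "X < m * X"
      using that(1) by simp
    have D: "q * u + v = X + Y"
      by (simp add: X_def Y_def algebra_simps)
    show "step u v < m"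
      using that X Y2 by (simp add: step_less_iff D X_def[symmetric] add.assoc distrib_left)
    have "X + Y < m * (R + X)"
      using X Y1 by (simp add: algebra_simps)
    then have "1 / m * (X + Y) < R + X"
      using that(1) by (simp add: field_simps)
    then show "1 / m < step u v"
      using that by (simp add: less_step_iff D X_def[symmetric] add.assoc)
  qed
  have M_gt_1: "M v u > 1" if "u > 0" "v > 0" "u \<noteq> 1 \<or> v \<noteq> 1" for u v
    using that by (auto simp: M_def less_max_iff_disj)
  have M_self: "M v u \<le> M v u" for v u
    by simp
  have mono: "M u (step u v) \<le> M v u" if "u > 0" "v > 0" for u v
  proof (cases "u = 1 \<and> v = 1")
    case False
    then have m: "M v u > 1"
      using M_gt_1 that by blast
    show ?thesis
      using key[OF m that M_self] M_le_iff[OF that, of "M v u"] m that step_pos[OF that]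
      by (simp add: M_le_iff)
  qed (simp add: step_1_1)
  have strict: "M (step u v) (step (step u v) u) < M v u"
    if uv: "u > 0" "v > 0" and ne: "u \<noteq> 1 \<or> v \<noteq> 1" for u v
  proof -
    have m: "M v u > 1"
      using M_gt_1 that by blast
    note w = step_pos[OF uv]
    show ?thesis
      using key[OF m uv M_self] key[OF m w uv(1) mono[OF uv]] m w step_pos[OF w uv(1)]
      by (simp add: M_less_iff)
  qed
  have "y \<longlonglongrightarrow> 1"
  proof (rule converges_if_Lyapunov[where V = M, OF y])
    show "continuous_on ({0<..} \<times> {0<..}) (\<lambda>z. M (fst z) (snd z))"
      unfolding M_def by (intro continuous_intros) auto
  qed (fact mono strict)+
  then show ?thesis
    by (rule settles_if_converges)
qed

section \<open>The perturbed Lyness equation\<close>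

text \<open>
  The Lyapunov function \<open>V\<close> is normalised so that its change is a sum of one term with factor \<open>G\<close>
  and one with factor \<open>q\<close>, without further dependence on these parameters.
\<close>
lemma settles_if_q_less_P:
  assumes y: "orbit y" and "q < P"
  shows "settles y"
proof -
  define g where "g = 1 - G"
  define l where "l = (P - q) / g"
  have g: "g > 0" "P - q < g"
    using normal pos \<open>q < P\<close> by (auto simp: g_def)
  have l: "0 < l" "l < 1"
    using g \<open>q < P\<close> by (auto simp: l_def)
  have "g * l = P - q"
    using g by (simp add: l_def)
  then have PR: "P = q + g * l" "R = g * (1 - l)" "G = 1 - g"
    using normal by (auto simp: g_def right_diff_distrib)
  define V where "V = (\<lambda>v u. g / l * lyness l v u + G * ((1 + l) / 2 * (u + 1 / u))
    + q * (l * (u - 1)\<^sup>2 / ((1 - l) + l * u)))"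
  have decrease: "V u (step u v) < V v u"
    if uv: "u > 0" "v > 0" and ne: "u \<noteq> 1 \<or> v \<noteq> 1" for u v
  proof -
    define w where "w = step u v"
    define m where "m = (1 - l) + l * u"
    have w: "w > 0"
      using step_pos uv by (simp add: w_def)
    have m: "m > 0"
      using l uv by (simp add: m_def add_pos_pos)
    have w_eq: "R + P * u + G * v = w * (q * u + v)"
      using step_eq_iff[OF uv, of w] by (simp add: w_def)
    have ne': "u \<noteq> 1 \<or> w \<noteq> 1"
    proof (rule ccontr)
      assume "\<not> ?thesis"
      then have "u = 1" "g * (v - 1) = 0"
        using w_eq PR by (auto simp: algebra_simps)
      then show False
        using ne g by simp
    qed
    \<comment> \<open>How far \<open>w\<close> is from the next Lyness term: \<open>w\<close> lies between that term and 1.\<close>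
    have defect: "g * (w * v - m) = - (w - 1) * (q * u + G * v)"
      using w_eq unfolding PR m_def by algebra
    have "g * ((w - 1) * (m - w * v)) = (w - 1)\<^sup>2 * (q * u + G * v)"
      using defect by algebra
    also have "\<dots> \<ge> 0"
      using pos uv by simp
    finally have sign: "(w - 1) * (m - w * v) \<ge> 0"
      using g by (simp add: zero_le_mult_iff)
    \<comment> \<open>For fixed \<open>u\<close> and \<open>w\<close> the worst \<open>v\<close> is \<open>m / w\<close>, for which \<open>w\<close> is exactly the next Lyness
      term.  Replacing \<open>v\<close> by it leaves inequalities in \<open>u\<close> and \<open>w\<close> alone.\<close>
    have "(w - 1) * (w - v) / (u * w) - (w - 1) * (w - m / w) / (u * w)
        = (w - 1) * (m - w * v) / (u * w\<^sup>2)"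
      using uv w by (simp add: field_simps power2_eq_square)
    also have "\<dots> \<ge> 0"
      using sign uv w by simp
    finally have 1: "(w - 1) * (w - m / w) / (u * w) \<le> (w - 1) * (w - v) / (u * w)"
      by simp
    have "(w - 1) * (w - v) / (w * v) - (w - 1) * (w\<^sup>2 / m - 1) / w
        = (w - 1) * (m - w * v) / (m * v)"
      using uv w m by (simp add: field_simps power2_eq_square)
    also have "\<dots> \<ge> 0"
      using sign uv m by simp
    finally have 2: "(w - 1) * (w\<^sup>2 / m - 1) / w \<le> (w - 1) * (w - v) / (w * v)"
      by simp
    have "g / l * (lyness l u w - lyness l v u)
        = (l + u) / (u * w * v) * ((w - v) * (g * (w * v - m)))"
      using l by (simp add: lyness_diff[OF uv w] m_def)
    also have "\<dots> = - G * ((l + u) * ((w - 1) * (w - v) / (u * w)))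
        - q * ((l + u) * ((w - 1) * (w - v) / (w * v)))"
      unfolding defect using uv w by (simp add: divide_simps) algebra
    finally have I: "g / l * (lyness l u w - lyness l v u)
      = - G * ((l + u) * ((w - 1) * (w - v) / (u * w)))
        - q * ((l + u) * ((w - 1) * (w - v) / (w * v)))" .
    have "V u w - V v u = g / l * (lyness l u w - lyness l v u)
      + G * ((1 + l) / 2 * (w + 1 / w) - (1 + l) / 2 * (u + 1 / u))
      + q * (l * (w - 1)\<^sup>2 / ((1 - l) + l * w) - l * (u - 1)\<^sup>2 / m)"
      unfolding V_def m_def[symmetric] by (simp only: right_diff_distrib)
    then have 3: "V u w - V v u =
        G * (((1 + l) / 2 * (w + 1 / w) - (1 + l) / 2 * (u + 1 / u))
             - (l + u) * ((w - 1) * (w - v) / (u * w)))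
      + q * ((l * (w - 1)\<^sup>2 / ((1 - l) + l * w) - l * (u - 1)\<^sup>2 / m)
             - (l + u) * ((w - 1) * (w - v) / (w * v)))"
      unfolding I by (simp only: right_diff_distrib)
    have "(1 + l) / 2 * (w + 1 / w) - (1 + l) / 2 * (u + 1 / u)
        < (l + u) * ((w - 1) * (w - m / w) / (u * w))"
      using reciprocal_change_less[OF l uv(1) w ne'] by (simp add: m_def mult.assoc)
    also have "\<dots> \<le> (l + u) * ((w - 1) * (w - v) / (u * w))"
      using 1 l uv by (intro mult_left_mono) auto
    finally have 4: "(1 + l) / 2 * (w + 1 / w) - (1 + l) / 2 * (u + 1 / u)
             - (l + u) * ((w - 1) * (w - v) / (u * w)) < 0"
      by simp
    have "l * (w - 1)\<^sup>2 / ((1 - l) + l * w) - l * (u - 1)\<^sup>2 / m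
        \<le> (l + u) * ((w - 1) * (w\<^sup>2 / m - 1) / w)"
      using quadratic_change_le[OF l uv(1) w] by (simp add: m_def mult.assoc)
    also have "\<dots> \<le> (l + u) * ((w - 1) * (w - v) / (w * v))"
      using 2 l uv by (intro mult_left_mono) auto
    finally have 5: "l * (w - 1)\<^sup>2 / ((1 - l) + l * w) - l * (u - 1)\<^sup>2 / m
             - (l + u) * ((w - 1) * (w - v) / (w * v)) \<le> 0"
      by simp
    have "V u w - V v u < 0"
      unfolding 3 using mult_pos_neg[OF pos(3) 4] mult_nonneg_nonpos[OF less_imp_le[OF pos(4)] 5]
      by linarith
    then show ?thesis
      by (simp add: w_def)
  qed
  have mono: "V u (step u v) \<le> V v u" if "u > 0" "v > 0" for u v
    using decrease[OF that] by (cases "u = 1 \<and> v = 1") (auto simp: step_1_1)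
  have "y \<longlonglongrightarrow> 1"
  proof (rule converges_if_Lyapunov[where V = V, OF y])
    show "V u (step u v) \<le> V v u" if "u > 0" "v > 0" for u v
      by (rule mono[OF that])
    show "V (step u v) (step (step u v) u) < V v u"
      if "u > 0" "v > 0" "u \<noteq> 1 \<or> v \<noteq> 1" for u v
      using mono[OF step_pos[OF that(1,2)] that(1)] decrease[OF that] by simp
    have "(1 - l) + l * x \<noteq> 0" if "x > 0" for x
      using l that add_pos_pos[of "1 - l" "l * x"] by simp
    then show "continuous_on ({0<..} \<times> {0<..}) (\<lambda>z. V (fst z) (snd z))"
      unfolding V_def lyness_def by (intro continuous_intros) (auto simp: mem_Times_iff)
  qed
  then show ?thesis
    by (rule settles_if_converges)
qed

section \<open>Coefficients of opposite sign: alternation around 1\<close>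

lemma limit_of_orbit:
  assumes y: "orbit y" and lim: "y \<longlonglongrightarrow> L"
  shows "L = 1"
proof -
  obtain l h where l: "0 < l" "\<And>n. l \<le> y n" and "\<And>n. y n \<le> h"
    using orbit_bounded[OF y] by blast
  have L: "L > 0"
    using LIMSEQ_le_const[OF lim, of l] l by force
  have "(\<lambda>n. step (y (n + 1)) (y n)) \<longlonglongrightarrow> step L L"
    unfolding step_def using denominator_pos[OF L L]
    by (intro tendsto_intros LIMSEQ_ignore_initial_segment lim) auto
  moreover have "(\<lambda>n. step (y (n + 1)) (y n)) \<longlonglongrightarrow> L"
    using LIMSEQ_ignore_initial_segment[OF lim, of 2] orbitD(2)[OF y] by simp
  ultimately show ?thesis
    using fixed_point_unique[OF L] LIMSEQ_unique by blast
qed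

end

locale small_P_large_G = normalised_recursion +
  assumes P_le_q: "P \<le> q" and G_ge_1: "1 \<le> G"
begin

text \<open>
  At \<open>u = threshold\<close> the next term is \<open>G\<close> whatever \<open>v\<close> is.  This is where the recursion changes
  its direction of monotonicity in \<open>v\<close>.
\<close>
definition threshold :: real where
  "threshold = R / (G * q - P)"

lemma q_minus_P: "q - P = R + (G - 1)"
  using normal by simp

lemma Gq_minus_P_pos: "G * q - P > 0"
proof -
  have "q \<le> G * q"
    using G_ge_1 pos by simp
  then show ?thesis
    using q_minus_P G_ge_1 pos by linarith
qed

lemma R_eq: "R = threshold * (G * q - P)"
  using Gq_minus_P_pos by (simp add: threshold_def)

lemma threshold_pos: "threshold > 0"
  using Gq_minus_P_pos pos by (simp add: threshold_def)

lemma threshold_le_1: "threshold \<le> 1"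
proof -
  have "G * q - P - R = (G - 1) * (q + 1)"
    using normal by algebra
  also have "\<dots> \<ge> 0"
    using G_ge_1 pos by simp
  finally show ?thesis
    using Gq_minus_P_pos by (simp add: threshold_def)
qed

lemma step_le_G_iff:
  assumes "u > 0" "v > 0"
  shows "step u v \<le> G \<longleftrightarrow> threshold \<le> u"
proof -
  have "step u v \<le> G \<longleftrightarrow> R \<le> (G * q - P) * u"
    using assms by (simp add: step_le_iff algebra_simps)
  then show ?thesis
    using Gq_minus_P_pos by (simp add: threshold_def pos_divide_le_eq mult.commute)
qed

lemma step_antimono_newer:
  assumes "0 < u" "u \<le> u'" "0 < v"
  shows "step u' v \<le> step u v"
proof -
  have "0 \<le> (u' - u) * (q * R + (G * q - P) * v)"
    using assms pos Gq_minus_P_pos by simp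
  also have "\<dots> = (R + P * u + G * v) * (q * u' + v) - (R + P * u' + G * v) * (q * u + v)"
    by algebra
  finally show ?thesis
    unfolding step_def using denominator_pos[of u v] denominator_pos[of u' v] assms
    by (simp add: frac_le_eq divide_le_0_iff)
qed

lemma step_mono_older:
  assumes "threshold \<le> u" "0 < v" "v \<le> v'"
  shows "step u v \<le> step u v'"
proof -
  have u: "u > 0"
    using assms threshold_pos by simp
  have "0 \<le> (v' - v) * ((G * q - P) * (u - threshold))"
    using assms Gq_minus_P_pos by simp
  also have "\<dots> = (R + P * u + G * v') * (q * u + v) - (R + P * u + G * v) * (q * u + v')"
    using R_eq by algebra
  finally show ?thesis
    unfolding step_def using denominator_pos[of u v] denominator_pos[of u v'] assms u
    by (simp add: frac_le_eq divide_le_0_iff)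
qed

lemma settles_if_ge_threshold:
  assumes y: "orbit y" and ge: "\<And>n. threshold \<le> y n"
  shows "settles y"
proof -
  obtain l h where "0 < l" and bounds: "\<And>n. l \<le> y n" "\<And>n. y n \<le> h"
    using orbit_bounded[OF y] by blast
  have "convergent (\<lambda>n. y (2 * n)) \<and> convergent (\<lambda>n. y (2 * n + 1))"
  proof (rule even_odd_convergent_if_mixed_monotone[where f = step, OF _ _ bounds])
    show "step (y j) (y k) \<le> step (y i) (y m)" if "y i \<le> y j" "y k \<le> y m" for i j k m
      by (rule order_trans[OF step_mono_older[OF ge orbitD(1)[OF y] that(2)]
          step_antimono_newer[OF orbitD(1)[OF y] that(1) orbitD(1)[OF y]]])
  qed (rule orbitD(2)[OF y])
  then obtain s t where s: "(\<lambda>n. y (2 * n)) \<longlonglongrightarrow> s" and t: "(\<lambda>n. y (2 * n + 1)) \<longlonglongrightarrow> t"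
    by (auto simp: convergent_def)
  have s': "(\<lambda>n. y (2 * n + 2)) \<longlonglongrightarrow> s" and t': "(\<lambda>n. y (2 * n + 3)) \<longlonglongrightarrow> t"
    using LIMSEQ_Suc[OF s] LIMSEQ_Suc[OF t] by (simp_all add: numeral_eq_Suc)
  have st: "s > 0" "t > 0"
    using LIMSEQ_le_const[OF s, of threshold] LIMSEQ_le_const[OF t, of threshold] ge threshold_pos by force+
  have "(\<lambda>n. step (y (2 * n + 1)) (y (2 * n))) \<longlonglongrightarrow> step t s"
    unfolding step_def using denominator_pos[OF st(2,1)] by (intro tendsto_intros s t) auto
  moreover have "y (2 * n + 2) = step (y (2 * n + 1)) (y (2 * n))" for n
    using orbitD(2)[OF y, of "2 * n"] by simp
  ultimately have "step t s = s"
    using LIMSEQ_unique[OF s', of "step t s"] by simp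
  have "(\<lambda>n. step (y (2 * n + 2)) (y (2 * n + 1))) \<longlonglongrightarrow> step s t"
    unfolding step_def using denominator_pos[OF st] by (intro tendsto_intros s' t) auto
  moreover have "y (2 * n + 3) = step (y (2 * n + 2)) (y (2 * n + 1))" for n
    using orbitD(2)[OF y, of "2 * n + 1"] by (simp add: numeral_eq_Suc)
  ultimately have "step s t = t"
    using LIMSEQ_unique[OF t', of "step s t"] by simp
  show ?thesis
    unfolding settles_def using st s t \<open>step t s = s\<close> \<open>step s t = t\<close> by blast
qed

text \<open>
  Write \<open>s\<close> for the terms below 1 and \<open>t\<close> for those above.  The conditions \<open>threshold \<le> s\<close> and
  \<open>t \<le> G\<close> imply each other from one term to the next, so either they hold from some index on, and the
  recursion is mixed monotone there, or \<open>t > G\<close> always.  In the latter case the step from \<open>s\<close> to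
  the next lower term is at least a positive multiple of the gap \<open>t - s\<close>; since the lower terms are
  bounded by 1, the gap tends to 0.
\<close>
lemma settles_if_alternating:
  assumes y: "orbit y" and alt: "\<And>k. y (2 * k) \<le> 1" "\<And>k. 1 \<le> y (2 * k + 1)"
  shows "settles y"
proof (cases "\<exists>k. y (2 * k + 1) \<le> G")
  case True
  then obtain k where k: "y (2 * k + 1) \<le> G"
    by blast
  have stay: "threshold \<le> y (2 * j + 2) \<and> y (2 * j + 3) \<le> G" if t: "y (2 * j + 1) \<le> G" for j
  proof -
    define s t where "s = y (2 * j)" and "t = y (2 * j + 1)"
    have st: "0 < s" "s \<le> 1" "1 \<le> t" "t \<le> G"
      using t alt orbitD(1)[OF y] by (auto simp: s_def t_def)
    have "0 \<le> threshold * q * (G - t) + P * (t - threshold) + s * (G - threshold)"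
      using st threshold_pos threshold_le_1 pos by (intro add_nonneg_nonneg mult_nonneg_nonneg) auto
    also have "\<dots> = R + P * t + G * s - threshold * (q * t + s)"
      using R_eq by algebra
    finally have "threshold \<le> step t s"
      using st by (simp add: le_step_iff)
    then have *: "threshold \<le> y (2 * j + 2)"
      using orbitD(2)[OF y, of "2 * j"] by (simp add: s_def t_def)
    moreover have "y (2 * j + 3) = step (y (2 * j + 2)) (y (2 * j + 1))"
      using orbitD(2)[OF y, of "2 * j + 1"] by (simp add: numeral_eq_Suc)
    ultimately show ?thesis
      using step_le_G_iff orbitD(1)[OF y] by simp
  qed
  have odd: "y (2 * (k + j) + 1) \<le> G" for j
  proof (induction j)
    case (Suc j)
    then show ?case
      using stay[of "k + j"] by (simp add: numeral_eq_Suc)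
  qed (use k in simp)
  have "threshold \<le> y (n + (2 * k + 1))" for n
  proof (cases "even n")
    case True
    then obtain j where "n = 2 * j" by (elim evenE)
    then show ?thesis
      using alt(2)[of "j + k"] threshold_le_1 by (simp add: algebra_simps)
  next
    case False
    then obtain j where "n = 2 * j + 1" by (elim oddE)
    then show ?thesis
      using stay[OF odd[of j]] by (simp add: algebra_simps)
  qed
  then show ?thesis
    using settles_if_ge_threshold[OF orbit_shift[OF y]] settles_if_settles_shift by blast
next
  case False
  then have t_gt: "y (2 * k + 1) > G" for k
    by (auto simp: not_le)
  obtain l h where "0 < l" "\<And>n. l \<le> y n" and h: "\<And>n. y n \<le> h"
    using orbit_bounded[OF y] by blast
  define s t where "s = (\<lambda>k. y (2 * k + 2))" and "t = (\<lambda>k. y (2 * k + 3))"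
  have st: "0 < s k" "s k \<le> 1" "1 \<le> t k" "G < t k" "t k \<le> h" for k
    using alt(1)[of "k + 1"] alt(2)[of "k + 1"] t_gt[of "k + 1"] h orbitD(1)[OF y]
    by (simp_all add: s_def t_def numeral_eq_Suc)
  have gap: "P * (t k - s k) \<le> (q + 1) * h * (s (Suc k) - s k)" "s k \<le> s (Suc k)" for k
  proof -
    define t0 where "t0 = y (2 * k + 1)"
    have t0: "t0 > G"
      using t_gt by (simp add: t0_def)
    have "t k = step (s k) t0" "s (Suc k) = step (t k) (s k)"
      using orbitD(2)[OF y, of "2 * k + 1"] orbitD(2)[OF y, of "2 * k + 2"]
      by (simp_all add: s_def t_def t0_def numeral_eq_Suc)
    moreover have "t0 > 0" "t k > 0"
      using t0 st(3)[of k] pos by linarith+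
    ultimately have t_eq: "R + P * s k + G * t0 = t k * (q * s k + t0)"
      and s_eq: "R + P * t k + G * s k = s (Suc k) * (q * t k + s k)"
      using step_eq_iff[of "s k" t0 "t k"] step_eq_iff[of "t k" "s k" "s (Suc k)"] st(1)[of k]
      by simp_all
    \<comment> \<open>Eliminating \<open>R\<close> between the two steps leaves \<open>P * (t k - s k)\<close> and these nonnegative
      terms.\<close>
    have "0 \<le> (t k - G) * (t0 - G) + G * (t k - G) + s k * (G - s k)"
      using st[of k] t0 G_ge_1 by (intro add_nonneg_nonneg mult_nonneg_nonneg) auto
    also have "\<dots> = (s (Suc k) - s k) * (q * t k + s k) - P * (t k - s k)"
      using t_eq s_eq by algebra
    finally have *: "P * (t k - s k) \<le> (s (Suc k) - s k) * (q * t k + s k)"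
      by simp
    moreover have "0 \<le> P * (t k - s k)"
      using st[of k] pos by simp
    moreover have D: "q * t k + s k > 0"
      using denominator_pos st[of k] by simp
    ultimately show le: "s k \<le> s (Suc k)"
      using zero_le_mult_iff[of "s (Suc k) - s k" "q * t k + s k"] by linarith
    have "q * t k + s k \<le> q * h + h"
      using st[of k] pos by (intro add_mono mult_left_mono) auto
    then have "(s (Suc k) - s k) * (q * t k + s k) \<le> (s (Suc k) - s k) * (q * h + h)"
      using le by (intro mult_left_mono) auto
    then show "P * (t k - s k) \<le> (q + 1) * h * (s (Suc k) - s k)"
      using * by (simp add: algebra_simps)
  qed
  have "incseq s"
    using gap(2) by (simp add: incseq_Suc_iff)
  then obtain \<sigma> where \<sigma>: "s \<longlonglongrightarrow> \<sigma>"
    using incseq_convergent[of s 1] st(2) by blast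
  have "(\<lambda>k. (q + 1) * h * (s (Suc k) - s k) / P) \<longlonglongrightarrow> (q + 1) * h * (\<sigma> - \<sigma>) / P"
    using pos by (intro tendsto_intros LIMSEQ_Suc \<sigma>) auto
  then have upper: "(\<lambda>k. (q + 1) * h * (s (Suc k) - s k) / P) \<longlonglongrightarrow> 0"
    by simp
  have "t k - s k \<le> (q + 1) * h * (s (Suc k) - s k) / P" for k
    using gap(1)[of k] pos by (simp add: pos_le_divide_eq mult.commute)
  moreover have "0 \<le> t k - s k" for k
    using st(2,3)[of k] by simp
  ultimately have "(\<lambda>k. t k - s k) \<longlonglongrightarrow> 0"
    by (intro tendsto_sandwich[OF _ _ tendsto_const upper]) auto
  then have \<tau>: "t \<longlonglongrightarrow> \<sigma>"
    using tendsto_add[OF _ \<sigma>, of "\<lambda>k. t k - s k" 0] by simp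
  have "\<sigma> = 1"
    using LIMSEQ_le_const2[OF \<sigma>, of 1] LIMSEQ_le_const[OF \<tau>, of 1] st(2,3) by force
  have "settles (\<lambda>n. y (n + 2))"
    unfolding settles_def using \<sigma> \<tau> step_1_1
    by (intro exI[of _ 1]) (simp add: \<open>\<sigma> = 1\<close> s_def t_def numeral_eq_Suc)
  then show ?thesis
    by (rule settles_if_settles_shift)
qed

lemma step_compared_to_1:
  assumes "u > 0" "v > 0"
  shows "step u v < 1 \<longleftrightarrow> (G - 1) * (v - 1) < (q - P) * (u - 1)"
    and "1 < step u v \<longleftrightarrow> (q - P) * (u - 1) < (G - 1) * (v - 1)"
proof -
  have "(R + P * u + G * v) - (q * u + v) = (G - 1) * (v - 1) - (q - P) * (u - 1)"
    using normal by algebra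
  then show "step u v < 1 \<longleftrightarrow> (G - 1) * (v - 1) < (q - P) * (u - 1)"
    and "1 < step u v \<longleftrightarrow> (q - P) * (u - 1) < (G - 1) * (v - 1)"
    unfolding step_less_iff[OF assms] less_step_iff[OF assms] by auto
qed

text \<open>
  Two consecutive terms on opposite sides of 1 are followed by alternation.  If all terms lie
  strictly on one side, the weight \<open>q - P\<close> of the newer deviation exceeds the weight \<open>G - 1\<close> of the
  older one, and the sign of the next deviation forces the newer deviation to be the smaller:
  the orbit is monotone.
\<close>
lemma settles_if_P_le_q_G_ge_1:
  assumes y: "orbit y"
  shows "settles y"
proof -
  have le: "y (n + 2) \<le> 1" if "y n \<le> 1" "1 \<le> y (n + 1)" for n
  proof -
    have "(G - 1) * (y n - 1) \<le> 0" "0 \<le> (q - P) * (y (n + 1) - 1)"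
      using that G_ge_1 P_le_q by (auto intro: mult_nonneg_nonpos)
    then show ?thesis
      using step_compared_to_1(2)[of "y (n + 1)" "y n"] orbitD[OF y] by (simp add: not_less[symmetric])
  qed
  have ge: "1 \<le> y (n + 2)" if "1 \<le> y n" "y (n + 1) \<le> 1" for n
  proof -
    have "0 \<le> (G - 1) * (y n - 1)" "(q - P) * (y (n + 1) - 1) \<le> 0"
      using that G_ge_1 P_le_q by (auto intro: mult_nonneg_nonpos)
    then show ?thesis
      using step_compared_to_1(1)[of "y (n + 1)" "y n"] orbitD[OF y] by (simp add: not_less[symmetric])
  qed
  consider (alt) N where "y N \<le> 1" "1 \<le> y (N + 1)"
    | (above) "\<forall>n. 1 < y n" | (below) "\<forall>n. y n < 1"
  proof (cases "\<exists>N. y N \<le> 1 \<and> 1 \<le> y (N + 1)")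
    case False
    then have no1: "y n \<le> 1 \<Longrightarrow> y (n + 1) < 1" for n
      by (meson not_le)
    have no2: "1 < y (n + 1)" if "1 \<le> y n" for n
    proof (rule ccontr)
      assume "\<not> 1 < y (n + 1)"
      then show False
        using ge[OF that] no1[of "n + 1"] by simp
    qed
    show thesis
    proof (cases "1 < y 0")
      case True
      have "1 < y n" for n
        by (induction n) (use True no2 in auto)
      then show thesis using that(2) by blast
    next
      case False
      then have "y 0 < 1"
        using no1[of 0] no2[of 0] by force
      then have "y n < 1" for n
        by (induction n) (use no1 in auto)
      then show thesis using that(3) by blast
    qed
  qed (use that(1) in blast)
  then show ?thesis
  proof cases
    case alt
    have alternating: "y (2 * k + N) \<le> 1 \<and> 1 \<le> y (2 * k + 1 + N)" for k
    proof (induction k)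
      case (Suc k)
      then show ?case
        using le[of "2 * k + N"] ge[of "2 * k + N + 1"] by (simp add: numeral_eq_Suc)
    qed (use alt in simp)
    have "settles (\<lambda>n. y (n + N))"
      by (rule settles_if_alternating[OF orbit_shift[OF y]]) (use alternating in auto)
    then show ?thesis
      by (rule settles_if_settles_shift)
  next
    case above
    have "y (Suc n) \<le> y n" for n
    proof -
      have "(q - P) * (y (n + 1) - 1) < (G - 1) * (y n - 1)"
        using spec[OF above, of "n + 2"] unfolding orbitD(2)[OF y]
          step_compared_to_1(2)[OF orbitD(1)[OF y] orbitD(1)[OF y]] .
      also have "\<dots> \<le> (q - P) * (y n - 1)"
        using q_minus_P pos(1) spec[OF above, of n] by (intro mult_right_mono) linarith+
      finally show ?thesis
        using P_le_q by (simp add: mult_less_cancel_left)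
    qed
    then have "decseq y"
      by (simp add: decseq_Suc_iff)
    then obtain L where "y \<longlonglongrightarrow> L"
      by (rule decseq_convergent[of y 1]) (use above in \<open>auto intro: less_imp_le\<close>)
    with limit_of_orbit[OF y this] show ?thesis
      by (simp add: settles_if_converges)
  next
    case below
    have "y n \<le> y (Suc n)" for n
    proof -
      have "y n - 1 \<le> 0"
        using spec[OF below, of n] by simp
      then have "(q - P) * (y n - 1) \<le> (G - 1) * (y n - 1)"
        using q_minus_P pos(1) by (intro mult_right_mono_neg) linarith+
      also have "\<dots> < (q - P) * (y (n + 1) - 1)"
        using spec[OF below, of "n + 2"] unfolding orbitD(2)[OF y]
          step_compared_to_1(1)[OF orbitD(1)[OF y] orbitD(1)[OF y]] .
      finally show ?thesis
        using P_le_q by (simp add: mult_less_cancel_left)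
    qed
    then have "incseq y"
      by (simp add: incseq_Suc_iff)
    then obtain L where "y \<longlonglongrightarrow> L"
      by (rule incseq_convergent[of y 1]) (use below in \<open>auto intro: less_imp_le\<close>)
    with limit_of_orbit[OF y this] show ?thesis
      by (simp add: settles_if_converges)
  qed
qed

end

section \<open>Back to the original equation\<close>

context normalised_recursion
begin

theorem every_orbit_settles:
  assumes "orbit y"
  shows "settles y"
proof (cases "q < P")
  case True
  then show ?thesis
    using settles_if_q_less_P assms by blast
next
  case False
  show ?thesis
  proof (cases "G \<le> 1")
    case True
    then show ?thesis
      using settles_if_P_le_q_G_le_1 assms \<open>\<not> q < P\<close> by simp
  next
    case G: False
    interpret small_P_large_G R P G q
      by unfold_locales (use G \<open>\<not> q < P\<close> in auto)
    show ?thesis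
      using settles_if_P_le_q_G_ge_1 assms by blast
  qed
qed

end

lemma tendsto_if_even_odd_tendsto:
  fixes d :: "nat \<Rightarrow> 'a::metric_space"
  assumes "(\<lambda>n. d (2 * n)) \<longlonglongrightarrow> a" "(\<lambda>n. d (2 * n + 1)) \<longlonglongrightarrow> a"
  shows "d \<longlonglongrightarrow> a"
  unfolding lim_sequentially
proof (intro allI impI)
  fix \<epsilon> :: real
  assume "\<epsilon> > 0"
  then obtain M N where M: "\<And>n. n \<ge> M \<Longrightarrow> dist (d (2 * n)) a < \<epsilon>"
    and N: "\<And>n. n \<ge> N \<Longrightarrow> dist (d (2 * n + 1)) a < \<epsilon>"
    using assms unfolding lim_sequentially by meson
  have "dist (d n) a < \<epsilon>" if "n \<ge> 2 * max M N + 1" for n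
    using that M[of "n div 2"] N[of "n div 2"] by (cases "even n") auto
  then show "\<exists>no. \<forall>n\<ge>no. dist (d n) a < \<epsilon>"
    by blast
qed

lemma is_equilibrium_iff:
  assumes "B > 0" "C > 0"
  shows "is_equilibrium \<alpha> \<beta> \<gamma> B C e \<longleftrightarrow> e > 0 \<and> \<alpha> + (\<beta> + \<gamma>) * e = (B + C) * e\<^sup>2"
proof -
  have "e = (\<alpha> + \<beta> * e + \<gamma> * e) / (B * e + C * e) \<longleftrightarrow> \<alpha> + (\<beta> + \<gamma>) * e = (B + C) * e\<^sup>2"
    if "e > 0"
  proof -
    have "B * e + C * e > 0"
      using assms that by (simp add: add_pos_pos)
    then show ?thesis
      by (simp add: eq_divide_eq algebra_simps power2_eq_square) auto
  qed
  then show ?thesis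
    unfolding is_equilibrium_def is_solution_def by auto
qed

lemma unique_equilibrium:
  assumes "\<alpha> > 0" "\<beta> > 0" "\<gamma> > 0" "B > 0" "C > 0"
  shows "\<exists>!e. is_equilibrium \<alpha> \<beta> \<gamma> B C e"
proof -
  define a b where "a = B + C" and "b = \<beta> + \<gamma>"
  have ab: "a > 0" "b > 0"
    using assms by (auto simp: a_def b_def)
  define r where "r = sqrt (b\<^sup>2 + 4 * a * \<alpha>)"
  have r: "r\<^sup>2 = b\<^sup>2 + 4 * a * \<alpha>" "r > 0"
    using ab assms by (auto simp: r_def intro!: add_pos_pos)
  define e where "e = (b + r) / (2 * a)"
  have e: "e > 0" "\<alpha> + b * e = a * e\<^sup>2"
    using ab r by (auto simp: e_def field_simps power2_eq_square)
  have "e' = e" if "e' > 0" "\<alpha> + b * e' = a * e'\<^sup>2" for e'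
  proof -
    \<comment> \<open>Multiply the equation of each root by the other root and subtract.\<close>
    have "(e' - e) * (a * e * e' + \<alpha>) = 0"
      using that(2) e(2) by algebra
    moreover have "a * e * e' + \<alpha> > 0"
      using that e ab assms by (simp add: add_pos_pos)
    ultimately show ?thesis
      by simp
  qed
  then show ?thesis
    unfolding is_equilibrium_iff[OF assms(4,5)] a_def[symmetric] b_def[symmetric]
    using e by blast
qed

theorem theorem2:
  fixes \<alpha> \<beta> \<gamma> A B C :: real
  assumes "\<alpha> > 0" and "\<beta> > 0" and "\<gamma> > 0" and "A > 0" and "B > 0" and "C > 0"
  shows "(\<exists>!e. is_equilibrium \<alpha> \<beta> \<gamma> B C e) \<and>
    (\<forall>x. is_solution \<alpha> \<beta> \<gamma> B C x \<longrightarrow>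
      (\<exists>e. is_equilibrium \<alpha> \<beta> \<gamma> B C e \<and> x \<longlonglongrightarrow> e) \<or>
      (\<exists>p. is_prime_period_two \<alpha> \<beta> \<gamma> B C p \<and> (\<lambda>n. x n - p n) \<longlonglongrightarrow> 0))"
proof (intro conjI allI impI)
  show ex1: "\<exists>!e. is_equilibrium \<alpha> \<beta> \<gamma> B C e"
    by (rule unique_equilibrium[OF assms(1-3,5,6)])
  fix x
  assume x: "is_solution \<alpha> \<beta> \<gamma> B C x"
  obtain e where equ: "is_equilibrium \<alpha> \<beta> \<gamma> B C e"
    using ex1 by blast
  then have e: "e > 0" and e_eq: "\<alpha> + (\<beta> + \<gamma>) * e = (B + C) * e\<^sup>2"
    using is_equilibrium_iff[OF assms(5,6)] by auto
  interpret normalised_recursion "\<alpha> / (C * e\<^sup>2)" "\<beta> / (C * e)" "\<gamma> / (C * e)" "B / C"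
  proof unfold_locales
    have "\<alpha> / (C * e\<^sup>2) + \<beta> / (C * e) + \<gamma> / (C * e) = (\<alpha> + (\<beta> + \<gamma>) * e) / (C * e\<^sup>2)"
      using assms e by (simp add: field_simps power2_eq_square)
    also have "\<dots> = B / C + 1"
      unfolding e_eq using assms e by (simp add: field_simps)
    finally show "\<alpha> / (C * e\<^sup>2) + \<beta> / (C * e) + \<gamma> / (C * e) = B / C + 1" .
  qed (use assms e in auto)
  have scale: "e * step u v = (\<alpha> + \<beta> * (e * u) + \<gamma> * (e * v)) / (B * (e * u) + C * (e * v))"
    if "u > 0" "v > 0" for u v
  proof -
    define N D where "N = \<alpha> + \<beta> * (e * u) + \<gamma> * (e * v)" and "D = B * (e * u) + C * (e * v)"
    have "\<alpha> / (C * e\<^sup>2) + \<beta> / (C * e) * u + \<gamma> / (C * e) * v = N / (C * e\<^sup>2)"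
      "B / C * u + v = D / (C * e)"
      unfolding N_def D_def using assms e by (simp_all add: field_simps power2_eq_square)
    then show ?thesis
      unfolding step_def N_def[symmetric] D_def[symmetric] using assms e
      by (simp add: power2_eq_square)
  qed
  have x_rec: "x (n + 2) = (\<alpha> + \<beta> * x (n + 1) + \<gamma> * x n) / (B * x (n + 1) + C * x n)" for n
    using x by (simp add: is_solution_def)
  have x_pos: "x n > 0 \<and> x (Suc n) > 0" for n
  proof (induction n)
    case (Suc n)
    then show ?case
      using x_rec[of n] assms by (simp add: add_pos_pos)
  qed (use x in \<open>auto simp: is_solution_def\<close>)
  define y where "y = (\<lambda>n. x n / e)"
  have xy: "x n = e * y n" for n
    using e by (simp add: y_def)
  have y_pos: "y n > 0" for n
    using x_pos e by (simp add: y_def)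
  have "e * y (n + 2) = e * step (y (n + 1)) (y n)" for n
    using x_rec[of n] scale[OF y_pos y_pos] by (simp add: xy)
  then have "orbit y"
    unfolding orbit_def using y_pos e by simp
  then obtain s t where st: "s > 0" "t > 0" "step t s = s" "step s t = t"
    and lim: "(\<lambda>n. y (2 * n)) \<longlonglongrightarrow> s" "(\<lambda>n. y (2 * n + 1)) \<longlonglongrightarrow> t"
    using every_orbit_settles[OF \<open>orbit y\<close>] unfolding settles_def by blast
  define p where "p = (\<lambda>n::nat. e * (if even n then s else t))"
  have "(\<lambda>n. x n - p n) \<longlonglongrightarrow> 0"
  proof (rule tendsto_if_even_odd_tendsto)
    have "(\<lambda>n. e * y (2 * n) - e * s) \<longlonglongrightarrow> e * s - e * s"
      by (intro tendsto_intros lim)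
    then show "(\<lambda>n. x (2 * n) - p (2 * n)) \<longlonglongrightarrow> 0"
      by (simp add: xy p_def)
    have "(\<lambda>n. e * y (2 * n + 1) - e * t) \<longlonglongrightarrow> e * t - e * t"
      by (intro tendsto_intros lim)
    then show "(\<lambda>n. x (2 * n + 1) - p (2 * n + 1)) \<longlonglongrightarrow> 0"
      by (simp add: xy p_def)
  qed
  show "(\<exists>e. is_equilibrium \<alpha> \<beta> \<gamma> B C e \<and> x \<longlonglongrightarrow> e) \<or>
      (\<exists>p. is_prime_period_two \<alpha> \<beta> \<gamma> B C p \<and> (\<lambda>n. x n - p n) \<longlonglongrightarrow> 0)"
  proof (cases "s = t")
    case True
    then have "p = (\<lambda>_. e)"
      using fixed_point_unique st by (auto simp: p_def)
    then have "x \<longlonglongrightarrow> e"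
      using \<open>(\<lambda>n. x n - p n) \<longlonglongrightarrow> 0\<close> by (simp add: LIM_zero_iff)
    then show ?thesis
      using equ by blast
  next
    case False
    have "is_solution \<alpha> \<beta> \<gamma> B C p"
      unfolding is_solution_def using e st scale[OF st(1,2)] scale[OF st(2,1)]
      by (auto simp: p_def)
    then have "is_prime_period_two \<alpha> \<beta> \<gamma> B C p"
      unfolding is_prime_period_two_def using False e by (auto simp: p_def)
    then show ?thesis
      using \<open>(\<lambda>n. x n - p n) \<longlonglongrightarrow> 0\<close> by blast
  qed
qed

end
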